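(* Let $L$ be a lattice satisfying the identities (HS), (U), (B), (E), and (P), and let $\Sigma$ be a join-seed of $L$. For any $a,b,c\in\Sigma$, if $a\mathbin{D}b$, $b\mathbin{D}c$, and $a\neq c$, then $a\mathbin{D}c$.
   Context: $\mathrm{J}(L)$ is the set of all (nonzero) join-irreducible elements of a lattice $L$. The join-dependency relation $D$ on $\mathrm{J}(L)$: $p\mathbin{D}q$ iff $p\neq q$ and there is $x\in L$ such that $p\leq q\vee x$ and $p\nleq y\vee x$ for every $y<q$. An inequality $p\leq x\vee y$ is minimal in $x$ if $p\nleq x'\vee y$ for all $x'<x$ in $L$ (similarly for $y$). A subset $\Sigma$ of $L$ is a join-seed if: (1) $\Sigma\subseteq\mathrm{J}(L)$; (2) every element of $L$ is a join of elements of $\Sigma$; (3) for all $p\in\Sigma$ and $a,b\in L$ with $p\leq a\vee b$, $p\nleq a$, $p\nleq b$, there are $x\leq a$ and $y\leq b$ both in $\Sigma$ such that $p\leq x\vee y$ is minimal in $x$ and $y$. The identities are as follows ($\mathfrak{S}_3$ is the group of permutations of $\{0,1,2\}$). (U): $x\wedge(x_0\vee x_1)\wedge(x_0\vee x_2)\wedge(x_1\vee x_2)=(x\wedge x_0\wedge(x_1\vee x_2))\vee(x\wedge x_1\wedge(x_0\vee x_2))\vee(x\wedge x_2\wedge(x_0\vee x_1))$. (B): $x\wedge(a_0\vee a_1)\wedge(b_0\vee b_1)=\bigvee_{i<2}\bigl[(x\wedge a_i\wedge(b_0\vee b_1))\vee(x\wedge b_i\wedge(a_0\vee a_1))\bigr]\vee\bigvee_{i<2}\bigl[x\wedge(a_0\vee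 a_1)\wedge(b_0\vee b_1)\wedge(a_0\vee b_i)\wedge(a_1\vee b_{1-i})\bigr]$. (E): $x\wedge\bigwedge_{i<3}(a\vee b_i)=\bigvee_{i<3}\bigl[x\wedge b_i\wedge\bigwedge_{j\neq i}(a\vee b_j)\bigr]\vee\bigvee_{\sigma\in\mathfrak{S}_3}\bigl[x\wedge(a\vee b^*_{0,\sigma})\wedge(a\vee b^*_{1,\sigma})\wedge(a\vee b_{\sigma(2)})\bigr]$, where $b^*_{0,\sigma}=b_{\sigma(0)}\wedge(x\vee b_{\sigma(1)})$ and $b^*_{1,\sigma}=b_{\sigma(1)}\wedge(x\vee b_{\sigma(2)})\wedge(b_{\sigma(0)}\vee b_{\sigma(2)})$. (P): with $b'=b\wedge(b_0\vee b_1)$, $a\wedge(b'\vee c)\wedge(c\vee d)=(a\wedge b'\wedge(c\vee d))\vee(a\wedge d\wedge(b'\vee c))\vee\bigl[a\wedge((b'\wedge(a\vee d))\vee c)\wedge(c\vee d)\bigr]\vee\bigvee_{i<2}\bigl[a\wedge(b_i\vee c)\wedge((b'\wedge(a\vee b_i)\wedge(b_i\vee d))\vee c)\wedge(c\vee d)\bigr]$. (HS): with $b'=b\wedge(b_0\vee b_1)$, $a\wedge(b'\vee c)=(a\wedge b')\vee\bigvee_{i<2}\bigl[a\wedge((b\wedge b_i)\vee c)\bigr]\vee\bigvee_{i<2}\bigl[a\wedge((b'\wedge(a\vee b_i))\vee c)\wedge(b_i\vee c)\wedge(b\vee b_{1-i})\bigr]\vee\bigvee_{i<2}\bigl[a\wedge((b'\wedge(a\vee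 b_i))\vee c)\wedge(b_0\vee c)\wedge(b_1\vee c)\bigr]$. *)

theory Defs
  imports "HOL-Combinatorics.Permutations"
begin

unbundle lattice_syntax

text \<open>
  The lattice \<open>L\<close> is the universe of a type of class \<^class>\<open>lattice\<close>; it need not have a least element.
\<close>

text \<open>The condition \<open>\<exists>y. \<not> p \<le> y\<close> says that \<open>p\<close> is not the least element (if there is one).\<close>

definition join_irreducible :: "'a::lattice \<Rightarrow> bool" where
  "join_irreducible p \<longleftrightarrow> (\<exists>y. \<not> p \<le> y) \<and> (\<forall>x y. p = x \<squnion> y \<longrightarrow> p = x \<or> p = y)"

definition join_dep :: "'a::lattice \<Rightarrow> 'a \<Rightarrow> bool" where
  "join_dep p q \<longleftrightarrow> join_irreducible p \<and> join_irreducible q \<and> p \<noteq> q \<and>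
     (\<exists>x. p \<le> q \<squnion> x \<and> (\<forall>y<q. \<not> p \<le> y \<squnion> x))"

definition minimal_cover :: "'a::lattice \<Rightarrow> 'a \<Rightarrow> 'a \<Rightarrow> bool" where
  "minimal_cover p x y \<longleftrightarrow> p \<le> x \<squnion> y \<and>
     (\<forall>x'<x. \<not> p \<le> x' \<squnion> y) \<and> (\<forall>y'<y. \<not> p \<le> x \<squnion> y')"

text \<open>Joins of infinite sets, and the empty join, are admitted when they exist.\<close>

definition is_join_of :: "'a::lattice \<Rightarrow> 'a set \<Rightarrow> bool" where
  "is_join_of x S \<longleftrightarrow> (\<forall>s\<in>S. s \<le> x) \<and> (\<forall>u. (\<forall>s\<in>S. s \<le> u) \<longrightarrow> x \<le> u)"

definition join_seed :: "'a::lattice set \<Rightarrow> bool" where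
  "join_seed \<Sigma> \<longleftrightarrow>
     \<Sigma> \<subseteq> {p. join_irreducible p} \<and>
     (\<forall>x. \<exists>S\<subseteq>\<Sigma>. is_join_of x S) \<and>
     (\<forall>p\<in>\<Sigma>. \<forall>a b. p \<le> a \<squnion> b \<and> \<not> p \<le> a \<and> \<not> p \<le> b \<longrightarrow>
        (\<exists>x\<in>\<Sigma>. \<exists>y\<in>\<Sigma>. x \<le> a \<and> y \<le> b \<and> minimal_cover p x y))"

text \<open>
  Each identity is given as its equation at a tuple of elements; a lattice satisfies it if the
  equation holds at all tuples. Indexed variables \<open>b\<^sub>0, b\<^sub>1, \<dots>\<close> are families on \<^typ>\<open>nat\<close>, of which only
  the values at \<open>i < 2\<close> or \<open>i < 3\<close> are used.
\<close>

definition U_eq :: "'a::lattice \<Rightarrow> 'a \<Rightarrow> 'a \<Rightarrow> 'a \<Rightarrow> bool" where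
  "U_eq x x0 x1 x2 \<longleftrightarrow>
     x \<sqinter> (x0 \<squnion> x1) \<sqinter> (x0 \<squnion> x2) \<sqinter> (x1 \<squnion> x2) =
       (x \<sqinter> x0 \<sqinter> (x1 \<squnion> x2)) \<squnion> (x \<sqinter> x1 \<sqinter> (x0 \<squnion> x2)) \<squnion> (x \<sqinter> x2 \<sqinter> (x0 \<squnion> x1))"

definition B_eq :: "'a::lattice \<Rightarrow> (nat \<Rightarrow> 'a) \<Rightarrow> (nat \<Rightarrow> 'a) \<Rightarrow> bool" where
  "B_eq x a b \<longleftrightarrow>
     x \<sqinter> (a 0 \<squnion> a 1) \<sqinter> (b 0 \<squnion> b 1) =
       Sup_fin ((\<lambda>i. (x \<sqinter> a i \<sqinter> (b 0 \<squnion> b 1)) \<squnion> (x \<sqinter> b i \<sqinter> (a 0 \<squnion> a 1))) ` {..<2}) \<squnion>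
       Sup_fin ((\<lambda>i. x \<sqinter> (a 0 \<squnion> a 1) \<sqinter> (b 0 \<squnion> b 1) \<sqinter> (a 0 \<squnion> b i) \<sqinter> (a 1 \<squnion> b (1 - i))) ` {..<2})"

definition E_eq :: "'a::lattice \<Rightarrow> 'a \<Rightarrow> (nat \<Rightarrow> 'a) \<Rightarrow> bool" where
  "E_eq x a b \<longleftrightarrow>
     x \<sqinter> Inf_fin ((\<lambda>i. a \<squnion> b i) ` {..<3}) =
       Sup_fin ((\<lambda>i. x \<sqinter> b i \<sqinter> Inf_fin ((\<lambda>j. a \<squnion> b j) ` ({..<3} - {i}))) ` {..<3}) \<squnion>
       Sup_fin ((\<lambda>\<sigma>.
           let b0s = b (\<sigma> 0) \<sqinter> (x \<squnion> b (\<sigma> 1));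
               b1s = b (\<sigma> 1) \<sqinter> (x \<squnion> b (\<sigma> 2)) \<sqinter> (b (\<sigma> 0) \<squnion> b (\<sigma> 2))
           in x \<sqinter> (a \<squnion> b0s) \<sqinter> (a \<squnion> b1s) \<sqinter> (a \<squnion> b (\<sigma> 2))) ` {\<sigma>. \<sigma> permutes {..<3}})"

text \<open>In the next two equations \<open>\<beta>\<close> is the family \<open>b\<^sub>0, b\<^sub>1\<close>, to be kept apart from the variable \<open>b\<close>.\<close>

definition P_eq :: "'a::lattice \<Rightarrow> 'a \<Rightarrow> 'a \<Rightarrow> 'a \<Rightarrow> (nat \<Rightarrow> 'a) \<Rightarrow> bool" where
  "P_eq a b c d \<beta> \<longleftrightarrow>
     (let b' = b \<sqinter> (\<beta> 0 \<squnion> \<beta> 1) in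
       a \<sqinter> (b' \<squnion> c) \<sqinter> (c \<squnion> d) =
         (a \<sqinter> b' \<sqinter> (c \<squnion> d)) \<squnion>
         (a \<sqinter> d \<sqinter> (b' \<squnion> c)) \<squnion>
         (a \<sqinter> ((b' \<sqinter> (a \<squnion> d)) \<squnion> c) \<sqinter> (c \<squnion> d)) \<squnion>
         Sup_fin ((\<lambda>i. a \<sqinter> (\<beta> i \<squnion> c) \<sqinter>
                        ((b' \<sqinter> (a \<squnion> \<beta> i) \<sqinter> (\<beta> i \<squnion> d)) \<squnion> c) \<sqinter> (c \<squnion> d)) ` {..<2}))"

definition HS_eq :: "'a::lattice \<Rightarrow> 'a \<Rightarrow> 'a \<Rightarrow> (nat \<Rightarrow> 'a) \<Rightarrow> bool" where
  "HS_eq a b c \<beta> \<longleftrightarrow>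
     (let b' = b \<sqinter> (\<beta> 0 \<squnion> \<beta> 1) in
       a \<sqinter> (b' \<squnion> c) =
         (a \<sqinter> b') \<squnion>
         Sup_fin ((\<lambda>i. a \<sqinter> ((b \<sqinter> \<beta> i) \<squnion> c)) ` {..<2}) \<squnion>
         Sup_fin ((\<lambda>i. a \<sqinter> ((b' \<sqinter> (a \<squnion> \<beta> i)) \<squnion> c) \<sqinter> (\<beta> i \<squnion> c) \<sqinter> (b \<squnion> \<beta> (1 - i))) ` {..<2}) \<squnion>
         Sup_fin ((\<lambda>i. a \<sqinter> ((b' \<sqinter> (a \<squnion> \<beta> i)) \<squnion> c) \<sqinter> (\<beta> 0 \<squnion> c) \<sqinter> (\<beta> 1 \<squnion> c)) ` {..<2}))"

unbundle no lattice_syntax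

end

theory Submission
  imports Defs
begin

text \<open>
  Choose \<open>e, d \<in> \<Sigma>\<close> such that \<open>a \<le> b \<squnion> e\<close> and \<open>b \<le> c \<squnion> d\<close> are minimal. By (HS), either
  \<open>a \<le> c \<squnion> e\<close>, or \<open>b \<le> a \<squnion> d\<close>, \<open>a \<le> d \<squnion> e\<close> and \<open>a \<le> b \<squnion> c\<close>. Shrink this cover of \<open>a\<close> by \<open>e\<close> and \<open>c\<close>,
  respectively \<open>b\<close> and \<open>c\<close>, to a minimal one, replacing \<open>c\<close> by \<open>c' \<le> c\<close>. If \<open>c' < c\<close>, then (P) and (B) in
  the first case, and (B) alone in the second, give \<open>b \<le> c' \<squnion> d\<close>, against the minimality of
  \<open>b \<le> c \<squnion> d\<close>. Hence \<open>c' = c\<close>, which means \<open>a D c\<close>.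
\<close>

unbundle lattice_syntax

lemma join_irreducible_eq_supD:
  assumes "join_irreducible p" "p = x \<squnion> y"
  shows "p = x \<or> p = y"
  using assms unfolding join_irreducible_def by blast

lemma image_lessThan_2: "f ` {..<2::nat} = {f 0, f 1}"
  by (auto simp: numeral_2_eq_2 lessThan_Suc)

text \<open>The two bounds make the left side of (B) equal to \<open>x\<close>, so \<open>x\<close>
  is a finite join and, being join-irreducible, equals one of the joinands.\<close>

lemma join_irreducible_B_cases:
  fixes x :: "'a::lattice"
  assumes B: "B_eq x (\<lambda>i. if i = 0 then a0 else a1) (\<lambda>i. if i = 0 then b0 else b1)"
    and x: "join_irreducible x" "x \<le> a0 \<squnion> a1" "x \<le> b0 \<squnion> b1"
  obtains "x \<le> a0" | "x \<le> a1" | "x \<le> b0" | "x \<le> b1"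
    | "x \<le> a0 \<squnion> b0" "x \<le> a1 \<squnion> b1" | "x \<le> a0 \<squnion> b1" "x \<le> a1 \<squnion> b0"
proof -
  have "x \<sqinter> (a0 \<squnion> a1) \<sqinter> (b0 \<squnion> b1) = x"
    using x by (simp add: inf.absorb1)
  with B have "x = ((x \<sqinter> a0 \<sqinter> (b0 \<squnion> b1)) \<squnion> (x \<sqinter> b0 \<sqinter> (a0 \<squnion> a1))) \<squnion>
      ((x \<sqinter> a1 \<sqinter> (b0 \<squnion> b1)) \<squnion> (x \<sqinter> b1 \<sqinter> (a0 \<squnion> a1))) \<squnion>
      ((x \<sqinter> (a0 \<squnion> b0) \<sqinter> (a1 \<squnion> b1)) \<squnion> (x \<sqinter> (a0 \<squnion> b1) \<sqinter> (a1 \<squnion> b0)))"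
    by (simp add: B_eq_def image_lessThan_2)
  then show thesis
    using that by (auto simp: inf.assoc inf.order_iff[symmetric] dest!: join_irreducible_eq_supD[OF x(1)])
qed

text \<open>The same reading of (P): \<open>b \<le> b0 \<squnion> b1\<close> makes the meet
  \<open>b'\<close> of the identity collapse to \<open>b\<close>.\<close>

lemma join_irreducible_P_cases:
  fixes a :: "'a::lattice"
  assumes P: "P_eq a b c d (\<lambda>i. if i = 0 then b0 else b1)"
    and a: "join_irreducible a" "a \<le> b \<squnion> c" "a \<le> c \<squnion> d" and b: "b \<le> b0 \<squnion> b1"
  obtains "a \<le> b" | "a \<le> d" | "a \<le> (b \<sqinter> (a \<squnion> d)) \<squnion> c"
    | "a \<le> b0 \<squnion> c" "a \<le> (b \<sqinter> (a \<squnion> b0) \<sqinter> (b0 \<squnion> d)) \<squnion> c"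
    | "a \<le> b1 \<squnion> c" "a \<le> (b \<sqinter> (a \<squnion> b1) \<sqinter> (b1 \<squnion> d)) \<squnion> c"
proof -
  have b': "b \<sqinter> (b0 \<squnion> b1) = b"
    using b by (simp add: inf.absorb1)
  have "a \<sqinter> (b \<squnion> c) \<sqinter> (c \<squnion> d) = a"
    using a by (simp add: inf.absorb1)
  with P b' have "a = (a \<sqinter> b \<sqinter> (c \<squnion> d)) \<squnion> (a \<sqinter> d \<sqinter> (b \<squnion> c)) \<squnion>
      (a \<sqinter> ((b \<sqinter> (a \<squnion> d)) \<squnion> c) \<sqinter> (c \<squnion> d)) \<squnion>
      ((a \<sqinter> (b0 \<squnion> c) \<sqinter> ((b \<sqinter> (a \<squnion> b0) \<sqinter> (b0 \<squnion> d)) \<squnion> c) \<sqinter> (c \<squnion> d)) \<squnion>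
       (a \<sqinter> (b1 \<squnion> c) \<sqinter> ((b \<sqinter> (a \<squnion> b1) \<sqinter> (b1 \<squnion> d)) \<squnion> c) \<sqinter> (c \<squnion> d)))"
    by (simp add: P_eq_def image_lessThan_2)
  then show thesis
    using that by (auto simp: inf.assoc inf.order_iff[symmetric] dest!: join_irreducible_eq_supD[OF a(1)])
qed

text \<open>The joinands of (HS) sharing the meet of \<open>b\<close> with
  \<open>a \<squnion> b0\<close>, or with \<open>a \<squnion> b1\<close>, are merged into one case
  each; the final disjunction records which of the two joinands occurred.\<close>

lemma join_irreducible_HS_cases:
  fixes a :: "'a::lattice"
  assumes HS: "HS_eq a b c (\<lambda>i. if i = 0 then b0 else b1)"
    and a: "join_irreducible a" "a \<le> b \<squnion> c" and b: "b \<le> b0 \<squnion> b1"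
  obtains "a \<le> b" | "a \<le> (b \<sqinter> b0) \<squnion> c" | "a \<le> (b \<sqinter> b1) \<squnion> c"
    | "a \<le> (b \<sqinter> (a \<squnion> b0)) \<squnion> c" "a \<le> b0 \<squnion> c"
    | "a \<le> (b \<sqinter> (a \<squnion> b1)) \<squnion> c" "a \<le> b1 \<squnion> c" "a \<le> b \<squnion> b0 \<or> a \<le> b0 \<squnion> c"
proof -
  have b': "b \<sqinter> (b0 \<squnion> b1) = b"
    using b by (simp add: inf.absorb1)
  have "a \<sqinter> (b \<squnion> c) = a"
    using a by (simp add: inf.absorb1)
  with HS b' have "a = (a \<sqinter> b) \<squnion>
      ((a \<sqinter> ((b \<sqinter> b0) \<squnion> c)) \<squnion> (a \<sqinter> ((b \<sqinter> b1) \<squnion> c))) \<squnion>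
      ((a \<sqinter> ((b \<sqinter> (a \<squnion> b0)) \<squnion> c) \<sqinter> (b0 \<squnion> c) \<sqinter> (b \<squnion> b1)) \<squnion>
       (a \<sqinter> ((b \<sqinter> (a \<squnion> b1)) \<squnion> c) \<sqinter> (b1 \<squnion> c) \<sqinter> (b \<squnion> b0))) \<squnion>
      ((a \<sqinter> ((b \<sqinter> (a \<squnion> b0)) \<squnion> c) \<sqinter> (b0 \<squnion> c) \<sqinter> (b1 \<squnion> c)) \<squnion>
       (a \<sqinter> ((b \<sqinter> (a \<squnion> b1)) \<squnion> c) \<sqinter> (b0 \<squnion> c) \<sqinter> (b1 \<squnion> c)))"
    by (simp add: HS_eq_def image_lessThan_2)
  then show thesis
    using that by (auto simp: inf.assoc inf.order_iff[symmetric] dest!: join_irreducible_eq_supD[OF a(1)])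
qed

text \<open>Otherwise \<open>x \<sqinter> z\<close> lies strictly below \<open>x\<close> and still
  covers. This turns the meets in (HS) and (P) into upper bounds of \<open>b\<close>.\<close>

lemma minimal_cover_inf_le:
  assumes "minimal_cover p x y" "p \<le> (x \<sqinter> z) \<squnion> y"
  shows "x \<le> z"
  using assms unfolding minimal_cover_def by (metis inf_le1 inf_le2 order_le_less)

lemma join_seed_minimal_cover:
  assumes "join_seed \<Sigma>" "p \<in> \<Sigma>" "p \<le> a \<squnion> b" "\<not> p \<le> a" "\<not> p \<le> b"
  obtains x y where "x \<in> \<Sigma>" "y \<in> \<Sigma>" "x \<le> a" "y \<le> b" "minimal_cover p x y"
  using assms unfolding join_seed_def by blast

text \<open>The seed shrinks the pair \<open>q\<close>, \<open>x\<close> to a minimal cover; only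
  the witness \<open>x\<close> can get smaller, since \<open>p \<le> q \<squnion> x\<close> is
  already minimal in \<open>q\<close>.\<close>

lemma join_dep_minimal_cover:
  fixes p q :: "'a::lattice"
  assumes seed: "join_seed \<Sigma>" and p: "p \<in> \<Sigma>" and dep: "join_dep p q"
  obtains y where "minimal_cover p q y" "\<not> p \<le> q" "\<not> p \<le> y"
proof -
  obtain x where x: "p \<le> q \<squnion> x" and min: "\<And>y. y < q \<Longrightarrow> \<not> p \<le> y \<squnion> x"
    using dep unfolding join_dep_def by blast
  obtain z where "\<not> q \<le> z"
    using dep unfolding join_dep_def join_irreducible_def by blast
  \<comment> \<open>Since \<open>q\<close> is not least, it has a strictly smaller element, and
    \<open>p \<le> x\<close> would contradict minimality there.\<close>
  then have "q \<sqinter> z < q"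
    by (metis inf.cobounded1 inf.cobounded2 order_le_less)
  then have px: "\<not> p \<le> x"
    using min by (meson le_supI2)
  have pq: "\<not> p \<le> q"
    using dep min unfolding join_dep_def by (metis le_supI1 order.refl order_le_less)
  obtain u y where u: "u \<le> q" and y: "y \<le> x" and cover: "minimal_cover p u y"
    using join_seed_minimal_cover[OF seed p x pq px] by metis
  have "p \<le> u \<squnion> x"
    using cover y unfolding minimal_cover_def by (meson order.trans order.refl sup_mono)
  then have "u = q"
    using min u order_le_less by blast
  then show thesis
    using that cover pq px y by (meson order.trans)
qed

lemma minimal_cover_imp_join_dep:
  assumes "join_irreducible p" "join_irreducible q" "p \<noteq> q" "minimal_cover p x q"
  shows "join_dep p q"
  using assms unfolding join_dep_def minimal_cover_def by (metis sup.commute)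

theorem corollary6p2:
  fixes \<Sigma> :: "'a::lattice set" and a b c :: 'a
  assumes HS: "\<forall>(x::'a) y z \<beta>. HS_eq x y z \<beta>"
    and U: "\<forall>(x::'a) x0 x1 x2. U_eq x x0 x1 x2"
    and B: "\<forall>(x::'a) \<alpha> \<beta>. B_eq x \<alpha> \<beta>"
    and E: "\<forall>(x::'a) y \<beta>. E_eq x y \<beta>"
    and P: "\<forall>(x::'a) y z w \<beta>. P_eq x y z w \<beta>"
    and seed: "join_seed \<Sigma>"
    and "a \<in> \<Sigma>" "b \<in> \<Sigma>" "c \<in> \<Sigma>"
    and "join_dep a b" "join_dep b c" "a \<noteq> c"
  shows "join_dep a c"
proof -
  have irr: "join_irreducible a" "join_irreducible b" "join_irreducible c"
    using \<open>join_dep a b\<close> \<open>join_dep b c\<close> unfolding join_dep_def by auto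
  obtain e where ae: "minimal_cover a b e" "\<not> a \<le> b" "\<not> a \<le> e"
    using join_dep_minimal_cover[OF seed \<open>a \<in> \<Sigma>\<close> \<open>join_dep a b\<close>] .
  obtain d where bd: "minimal_cover b c d" "\<not> b \<le> c" "\<not> b \<le> d"
    using join_dep_minimal_cover[OF seed \<open>b \<in> \<Sigma>\<close> \<open>join_dep b c\<close>] .
  have abe: "a \<le> b \<squnion> e" and bcd: "b \<le> c \<squnion> d"
    using ae(1) bd(1) unfolding minimal_cover_def by auto
  have be: "\<not> b \<le> e"
    using abe ae(3) by (metis sup.absorb2)
  have min_c: "c' = c" if "c' \<le> c" "b \<le> c' \<squnion> d" for c'
    using that bd(1) unfolding minimal_cover_def by (metis order_le_less)
  \<comment> \<open>(HS) is applied with the family \<open>c, d\<close>. Its first three cases would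
    give \<open>a \<le> b\<close>, \<open>b \<le> c\<close> or \<open>b \<le> d\<close>.\<close>
  have HS_cases: "b \<le> a \<squnion> c \<and> a \<le> c \<squnion> e \<or>
      b \<le> a \<squnion> d \<and> a \<le> d \<squnion> e \<and> (a \<le> b \<squnion> c \<or> a \<le> c \<squnion> e)"
    using join_irreducible_HS_cases[OF HS[rule_format] irr(1) abe bcd]
      minimal_cover_inf_le[OF ae(1)] ae(2) bd(2,3) by metis
  \<comment> \<open>If \<open>a \<le> c\<close>, the first alternative gives
    \<open>b \<le> c\<close>, and the second gives \<open>b \<le> a \<squnion> d\<close>, hence
    \<open>a = c\<close> by \<open>min_c\<close>.\<close>
  have ac: "\<not> a \<le> c"
    using HS_cases bd(2) min_c[of a] \<open>a \<noteq> c\<close> by (metis sup.absorb2)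
  show ?thesis
  proof (cases "a \<le> c \<squnion> e")
    case True
    then obtain e' c' where "e' \<le> e" "c' \<le> c" and cover: "minimal_cover a e' c'"
      using join_seed_minimal_cover[OF seed \<open>a \<in> \<Sigma>\<close> _ ae(3) ac] by (metis sup.commute)
    have aec: "a \<le> e \<squnion> c'"
      using cover \<open>e' \<le> e\<close> unfolding minimal_cover_def by (meson order.trans order.refl sup_mono)
    have ac': "\<not> a \<le> c'" and bc': "\<not> b \<le> c'" and "c \<squnion> c' = c"
      using ac bd(2) \<open>c' \<le> c\<close> by (auto simp: sup.absorb1)
    \<comment> \<open>In (P), \<open>e\<close> and \<open>c'\<close> play the roles of
      \<open>c\<close> and \<open>d\<close>, and the family is \<open>c, d\<close>. The case of
      \<open>c\<close> dies because it yields \<open>b \<le> c \<squnion> c' = c\<close>.\<close>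
    have "b \<le> a \<squnion> c' \<or> b \<le> c' \<squnion> d"
      using join_irreducible_P_cases[OF P[rule_format] irr(1) abe aec bcd]
        minimal_cover_inf_le[OF ae(1)] ae(2) ac' bd(2) \<open>c \<squnion> c' = c\<close>
      by (metis (no_types, lifting) inf.assoc le_inf_iff sup.commute)
    then have "b \<le> c' \<squnion> d"
    proof
      assume "b \<le> a \<squnion> c'"
      then have "b \<le> c' \<squnion> e"
        using aec by (metis (no_types, lifting) le_sup_iff order.trans sup.cobounded2 sup.commute)
      \<comment> \<open>(B) for \<open>b\<close> below \<open>c \<squnion> d\<close> and
        \<open>c' \<squnion> e\<close>: pairing \<open>c\<close> with \<open>c'\<close> gives
        \<open>b \<le> c\<close>, so \<open>d\<close> is paired with \<open>c'\<close>.\<close>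
      then show ?thesis
        using join_irreducible_B_cases[OF B[rule_format] irr(2) bcd]
          bd(2,3) bc' be \<open>c \<squnion> c' = c\<close> by (metis sup.commute)
    qed
    with min_c \<open>c' \<le> c\<close> have "c' = c" by blast
    with cover show ?thesis
      using minimal_cover_imp_join_dep irr \<open>a \<noteq> c\<close> by blast
  next
    case False
    with HS_cases have bad: "b \<le> a \<squnion> d" and ade: "a \<le> d \<squnion> e" and abc: "a \<le> b \<squnion> c"
      by auto
    obtain b' c' where "b' \<le> b" "c' \<le> c" and cover: "minimal_cover a b' c'"
      using join_seed_minimal_cover[OF seed \<open>a \<in> \<Sigma>\<close> abc ae(2) ac] by metis
    have abc': "a \<le> b \<squnion> c'"
      using cover \<open>b' \<le> b\<close> unfolding minimal_cover_def by (meson order.trans order.refl sup_mono)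
    have ad: "\<not> a \<le> d"
      using bad bd(3) by (metis sup.absorb2)
    have ac': "\<not> a \<le> c'" and aec': "\<not> a \<le> e \<squnion> c'"
      using False ac \<open>c' \<le> c\<close> by (auto simp: sup.commute intro: order.trans sup_mono)
    \<comment> \<open>(B) pairs \<open>d\<close> with \<open>b\<close> or with \<open>c'\<close>;
      the former pairs \<open>e\<close> with \<open>c'\<close>, excluded by
      \<open>aec'\<close>.\<close>
    have "a \<le> d \<squnion> c'"
      using join_irreducible_B_cases[OF B[rule_format] irr(1) ade abc'] ad ae(2,3) ac' aec'
      by metis
    then have "b \<le> c' \<squnion> d"
      using bad by (metis (no_types, lifting) le_sup_iff order.trans sup.cobounded2 sup.commute)
    with min_c \<open>c' \<le> c\<close> have "c' = c" by blast
    with cover show ?thesis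
      using minimal_cover_imp_join_dep irr \<open>a \<noteq> c\<close> by blast
  qed
qed

unbundle no lattice_syntax

end
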